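(* Let $H$ be the game $\mathrm{SN}(6,\mathcal{A})$ on stacks $a,b,c,d,e,f$ with maximal move sets $$\mathcal{A}=\{\{a,b,c\},\{b,c,d\},\{c,d,e\},\{d,e,f\},\{a,f\}\}.$$ Then the set of $\mathcal{P}$-positions of $H$, up to the reflection $(a,b,c,d,e,f)\mapsto(f,e,d,c,b,a)$, is $$\mathcal{P}_H=\{(a,b,c,d,e,f)\mid a\le f,\ a+b+c=d+e+f,\ a=d+\min(c,e)\}.$$ That is, a position is a $\mathcal{P}$-position of $H$ if and only if it or its reflection belongs to the displayed set.
   Context: The game SetNim $\mathrm{SN}(n,\mathcal{A})$ is played on $n$ stacks of tokens placed on a vertex set $V$, where $\mathcal{A}=\{A_1,\ldots,A_\ell\}$ is a collection of subsets of $V$ with $\bigcup_i A_i=V$. A position is a vector of non-negative integers (the stack heights). In each move a player selects a set $A_i\in\mathcal{A}$ and removes at least one token in total from the stacks in $A_i$ (any number of tokens may be removed from each stack of $A_i$, including none, as long as at least one token is removed overall). Two players alternate, and the last player to move wins. An $\mathcal{N}$-position is one from which the player about to move can win with optimal play; a $\mathcal{P}$-position is one from which the player about to move loses against optimal play. For $H$, positions are written $(a,b,c,d,e,f)$, each letter denoting both a stack and its number of tokens. The move sets of $H$ are symmetric under the reflection exchanging $a\leftrightarrow f$, $b\leftrightarrow e$, $c\leftrightarrow d$. *)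

theory Defs
  imports Main
begin

text \<open>
  SetNim on the stacks \<open>'v\<close>, with move sets \<open>\<A>\<close>; the vertex set is the whole type, so the
  standing assumption is \<open>\<Union>\<A> = UNIV\<close>. A position maps every stack to its number of tokens.
\<close>

definition setnim_move :: "'v set set \<Rightarrow> ('v \<Rightarrow> nat) \<Rightarrow> ('v \<Rightarrow> nat) \<Rightarrow> bool" where
  "setnim_move \<A> p q \<longleftrightarrow>
     (\<exists>X\<in>\<A>. (\<forall>v\<in>X. q v \<le> p v) \<and> (\<exists>v\<in>X. q v < p v) \<and> (\<forall>v. v \<notin> X \<longrightarrow> q v = p v))"

text \<open>
  Normal play: a player who cannot move has lost. The predicates are defined inductively, so
  membership means that a win is forced after finitely many moves: \<open>N_position\<close> by the player
  about to move, \<open>P_position\<close> by the other player.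
\<close>

inductive N_position :: "'v set set \<Rightarrow> ('v \<Rightarrow> nat) \<Rightarrow> bool"
  and P_position :: "'v set set \<Rightarrow> ('v \<Rightarrow> nat) \<Rightarrow> bool"
  for \<A> :: "'v set set"
where
  N_positionI: "setnim_move \<A> p q \<Longrightarrow> P_position \<A> q \<Longrightarrow> N_position \<A> p"
| P_positionI: "(\<And>q. setnim_move \<A> p q \<Longrightarrow> N_position \<A> q) \<Longrightarrow> P_position \<A> p"

datatype stack = St_a | St_b | St_c | St_d | St_e | St_f

definition H_sets :: "stack set set" where
  "H_sets = {{St_a, St_b, St_c}, {St_b, St_c, St_d}, {St_c, St_d, St_e}, {St_d, St_e, St_f},
             {St_a, St_f}}"

lemma Union_H_sets: "\<Union>H_sets = UNIV"
proof -
  have "v \<in> \<Union>H_sets" for v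
    by (cases v) (simp_all add: H_sets_def)
  then show ?thesis by blast
qed

fun position :: "nat \<times> nat \<times> nat \<times> nat \<times> nat \<times> nat \<Rightarrow> stack \<Rightarrow> nat" where
  "position (a, b, c, d, e, f) St_a = a"
| "position (a, b, c, d, e, f) St_b = b"
| "position (a, b, c, d, e, f) St_c = c"
| "position (a, b, c, d, e, f) St_d = d"
| "position (a, b, c, d, e, f) St_e = e"
| "position (a, b, c, d, e, f) St_f = f"

lemma bij_position: "bij position"
proof (rule bijI)
  show "inj position"
  proof (rule injI)
    fix x y assume eq: "position x = position y"
    obtain a b c d e f where x: "x = (a, b, c, d, e, f)" by (cases x)
    obtain a' b' c' d' e' f' where y: "y = (a', b', c', d', e', f')" by (cases y)
    have "position x v = position y v" for v using eq by simp
    from this[of St_a] this[of St_b] this[of St_c] this[of St_d] this[of St_e] this[of St_f]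
    show "x = y" by (simp add: x y)
  qed
  show "surj position"
  proof (rule surjI)
    fix p
    show "position (p St_a, p St_b, p St_c, p St_d, p St_e, p St_f) = p"
    proof
      fix v
      show "position (p St_a, p St_b, p St_c, p St_d, p St_e, p St_f) v = p v"
        by (cases v) simp_all
    qed
  qed
qed

fun reflection ::
  "nat \<times> nat \<times> nat \<times> nat \<times> nat \<times> nat \<Rightarrow> nat \<times> nat \<times> nat \<times> nat \<times> nat \<times> nat" where
  "reflection (a, b, c, d, e, f) = (f, e, d, c, b, a)"

definition P_H :: "(nat \<times> nat \<times> nat \<times> nat \<times> nat \<times> nat) set" where
  "P_H = {(a, b, c, d, e, f). a \<le> f \<and> a + b + c = d + e + f \<and> a = d + min c e}"

end

theory Submission
  imports Defs
begin

text \<open>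
  The \<open>\<P>\<close>-positions of a terminating game are its kernel: the only set of positions such that no
  move joins two of its members and every position outside has a move into it. So it suffices that
  the balanced positions (members of \<open>P_H\<close> and their reflections) have these two properties.

  Independence rests on the equation \<open>a + b + c = d + e + f\<close>. It forbids moves inside
  \<open>{a, b, c}\<close> or \<open>{d, e, f}\<close>. A move inside another set that stays in \<open>P_H\<close> preserves
  \<open>a = d + min c e\<close>, whose right-hand side is monotone; together with the half sums this pins down
  every stack that might change. A move that changes the orientation \<open>a \<le> f\<close> must end with \<open>a = f\<close>, where the two
  reflected conditions agree (\<open>P_H_reflection_iff\<close>), so it is not a new case.

  Absorption is an explicit strategy. By symmetry \<open>a \<le> f\<close>. If \<open>a \<le> d + min c e\<close>, the stack \<open>a\<close> is
  left alone and \<open>d\<close> and \<open>min c e\<close> are lowered until they sum to \<open>a\<close>, the remaining freedom being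
  used to equate the two half sums (\<open>absorbing_low_a\<close>). Otherwise \<open>a\<close> is too large, and the natural
  move is inside \<open>{a, f}\<close>, where the values of \<open>b, c, d, e\<close> determine the target. When the
  target is too high in one coordinate, a move inside \<open>{a, b, c}\<close> or \<open>{d, e, f}\<close> replaces it
  (\<open>absorbing_high_a\<close>). The comparison of \<open>b + c\<close> with \<open>d + e\<close> decides the orientation of the
  target, because under equal half sums it is the same as the comparison of \<open>f\<close> with \<open>a\<close>.
\<close>

section \<open>Kernels of SetNim\<close>

lemma setnim_move_iff:
  "setnim_move \<A> p q \<longleftrightarrow> q \<noteq> p \<and> (\<forall>v. q v \<le> p v) \<and> (\<exists>X\<in>\<A>. \<forall>v. v \<notin> X \<longrightarrow> q v = p v)"
proof
  show "setnim_move \<A> p q"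
    if proper: "q \<noteq> p \<and> (\<forall>v. q v \<le> p v) \<and> (\<exists>X\<in>\<A>. \<forall>v. v \<notin> X \<longrightarrow> q v = p v)"
  proof -
    obtain X where X: "X \<in> \<A>" "\<forall>v. v \<notin> X \<longrightarrow> q v = p v" using proper by blast
    obtain v where "q v \<noteq> p v" using proper by blast
    then have "v \<in> X" "q v < p v" using X proper by (auto simp: le_neq_implies_less)
    then show ?thesis unfolding setnim_move_def using X proper by blast
  qed
  show "q \<noteq> p \<and> (\<forall>v. q v \<le> p v) \<and> (\<exists>X\<in>\<A>. \<forall>v. v \<notin> X \<longrightarrow> q v = p v)"
    if move: "setnim_move \<A> p q"
  proof -
    obtain X where X: "X \<in> \<A>" "\<forall>v\<in>X. q v \<le> p v" "\<exists>v\<in>X. q v < p v" "\<forall>v. v \<notin> X \<longrightarrow> q v = p v"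
      using move unfolding setnim_move_def by blast
    have "q v \<le> p v" for v using X by (cases "v \<in> X") auto
    moreover have "q \<noteq> p" using X(3) by auto
    ultimately show ?thesis using X by blast
  qed
qed

lemma wfp_setnim_move:
  fixes \<A> :: "'v set set"
  assumes "finite (UNIV :: 'v set)"
  shows "wfp (\<lambda>q p. setnim_move \<A> p q)"
proof -
  have "sum q UNIV < sum p UNIV" if "setnim_move \<A> p q" for p q
  proof (rule sum_strict_mono_ex1[OF assms])
    show "\<forall>v\<in>UNIV. q v \<le> p v" using that unfolding setnim_move_iff by blast
    show "\<exists>v\<in>UNIV. q v < p v" using that unfolding setnim_move_def by blast
  qed
  then show ?thesis
    by (intro wfp_if_convertible_to_nat[where f = "\<lambda>p. sum p UNIV"])
qed

text \<open>
  Rule induction shows that a forced result is never contradicted by \<open>K\<close>; it needs no termination.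
  Termination gives the converse, that every position is decided.
\<close>

lemma P_position_iff_kernel:
  assumes wf: "wfp (\<lambda>q p. setnim_move \<A> p q)"
    and independent: "\<And>p q. p \<in> K \<Longrightarrow> setnim_move \<A> p q \<Longrightarrow> q \<notin> K"
    and absorbing: "\<And>p. p \<notin> K \<Longrightarrow> \<exists>q\<in>K. setnim_move \<A> p q"
  shows "P_position \<A> p \<longleftrightarrow> p \<in> K"
proof
  have "(N_position \<A> p \<longrightarrow> p \<notin> K) \<and> (P_position \<A> q \<longrightarrow> q \<in> K)" for p q
  proof (induction rule: N_position_P_position.induct)
    case (N_positionI p q)
    then show ?case using independent by blast
  next
    case (P_positionI p)
    then show ?case using absorbing by blast
  qed
  then show "p \<in> K" if "P_position \<A> p" using that by blast
next
  have "(p \<in> K \<longrightarrow> P_position \<A> p) \<and> (p \<notin> K \<longrightarrow> N_position \<A> p)" for p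
    using wf
  proof (induction p rule: wfp_induct_rule)
    case (less p)
    show ?case
    proof (cases "p \<in> K")
      case True
      then have "N_position \<A> q" if "setnim_move \<A> p q" for q
        using less that independent by blast
      then show ?thesis using True by (blast intro: P_positionI)
    next
      case False
      then show ?thesis using less absorbing by (blast intro: N_positionI)
    qed
  qed
  then show "P_position \<A> p" if "p \<in> K" using that by blast
qed

section \<open>Moves and balanced positions of \<open>H\<close>\<close>

lemma all_stack: "(\<forall>v. Q v) \<longleftrightarrow> Q St_a \<and> Q St_b \<and> Q St_c \<and> Q St_d \<and> Q St_e \<and> Q St_f"
  by (metis stack.exhaust)

lemma finite_UNIV_stack: "finite (UNIV :: stack set)"
proof -
  have "(UNIV :: stack set) \<subseteq> {St_a, St_b, St_c, St_d, St_e, St_f}"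
    using stack.exhaust by blast
  then show ?thesis by (rule finite_subset) simp
qed

lemma setnim_move_H_iff:
  "setnim_move H_sets (position (a, b, c, d, e, f)) (position (a', b', c', d', e', f')) \<longleftrightarrow>
     (a, b, c, d, e, f) \<noteq> (a', b', c', d', e', f') \<and>
     a' \<le> a \<and> b' \<le> b \<and> c' \<le> c \<and> d' \<le> d \<and> e' \<le> e \<and> f' \<le> f \<and>
     (d' = d \<and> e' = e \<and> f' = f \<or> a' = a \<and> e' = e \<and> f' = f \<or> a' = a \<and> b' = b \<and> f' = f \<or>
      a' = a \<and> b' = b \<and> c' = c \<or> b' = b \<and> c' = c \<and> d' = d \<and> e' = e)"
proof -
  have "position (a', b', c', d', e', f') \<noteq> position (a, b, c, d, e, f) \<longleftrightarrow>
      (a, b, c, d, e, f) \<noteq> (a', b', c', d', e', f')"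
    using bij_position by (metis bij_pointE)
  then show ?thesis
    unfolding setnim_move_iff all_stack H_sets_def
    by (simp only: position.simps bex_simps insert_iff empty_iff stack.distinct simp_thms conj_assoc)
qed

lemma setnim_move_H_reflection:
  "setnim_move H_sets (position (reflection x)) (position (reflection y)) \<longleftrightarrow>
     setnim_move H_sets (position x) (position y)"
proof -
  obtain a b c d e f where x: "x = (a, b, c, d, e, f)" by (cases x)
  obtain a' b' c' d' e' f' where y: "y = (a', b', c', d', e', f')" by (cases y)
  show ?thesis unfolding x y reflection.simps setnim_move_H_iff by auto
qed

lemma reflection_reflection [simp]: "reflection (reflection x) = x"
  by (cases x) simp

definition balanced :: "(nat \<times> nat \<times> nat \<times> nat \<times> nat \<times> nat) set" where
  "balanced = {x. x \<in> P_H \<or> reflection x \<in> P_H}"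

lemma balanced_iff:
  "(a, b, c, d, e, f) \<in> balanced \<longleftrightarrow> a + b + c = d + e + f \<and>
     (a \<le> f \<and> a = d + min c e \<or> f \<le> a \<and> f = c + min d b)"
  unfolding balanced_def P_H_def by auto

lemma reflection_balanced_iff [simp]: "reflection x \<in> balanced \<longleftrightarrow> x \<in> balanced"
  unfolding balanced_def by auto

section \<open>Independence\<close>

text \<open>
  With \<open>b + c = d + e\<close>, both \<open>d + min c e\<close> and \<open>c + min d b\<close> are the smaller of \<open>c + d\<close> and
  \<open>d + e = b + c\<close>. Under equal half sums, \<open>a = f\<close> means just \<open>b + c = d + e\<close>.
\<close>

lemma P_H_reflection_iff:
  assumes "a = f"
  shows "reflection (a, b, c, d, e, f) \<in> P_H \<longleftrightarrow> (a, b, c, d, e, f) \<in> P_H"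
  using assms unfolding P_H_def by auto

lemma P_H_no_move_to_P_H:
  assumes "(a, b, c, d, e, f) \<in> P_H" "(a', b', c', d', e', f') \<in> P_H"
  shows "\<not> setnim_move H_sets (position (a, b, c, d, e, f)) (position (a', b', c', d', e', f'))"
  using assms unfolding P_H_def setnim_move_H_iff by auto

text \<open>
  The orientation of a position with equal half sums can be read off either from \<open>a\<close> and \<open>f\<close> or
  from \<open>b + c\<close> and \<open>d + e\<close>. A move inside \<open>{b, c, d}\<close> or \<open>{c, d, e}\<close> leaves the first pair alone
  and one inside \<open>{a, f}\<close> the second. So a move can only reverse the orientation if that pair
  consists of equal numbers, whence \<open>a' = f'\<close>.
\<close>

lemma P_H_no_move_to_balanced:
  assumes "x \<in> P_H" "y \<in> balanced"
  shows "\<not> setnim_move H_sets (position x) (position y)"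
proof
  assume move: "setnim_move H_sets (position x) (position y)"
  obtain a b c d e f where x: "x = (a, b, c, d, e, f)" by (cases x)
  obtain a' b' c' d' e' f' where y: "y = (a', b', c', d', e', f')" by (cases y)
  show False
  proof (cases "y \<in> P_H")
    case True
    then show False using P_H_no_move_to_P_H assms(1) move unfolding x y by blast
  next
    case False
    then have refl_y: "reflection y \<in> P_H" using assms(2) unfolding balanced_def by blast
    have "a' = f'"
    proof -
      have sums: "a + b + c = d + e + f" "a' + b' + c' = d' + e' + f'" "a \<le> f" "f' \<le> a'"
        using assms(1) refl_y unfolding x y P_H_def by auto
      then show ?thesis using move unfolding x y setnim_move_H_iff by auto
    qed
    then show False using P_H_reflection_iff refl_y False unfolding y by blast
  qed
qed

lemma balanced_independent:
  assumes "x \<in> balanced" "setnim_move H_sets (position x) (position y)"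
  shows "y \<notin> balanced"
proof
  assume y: "y \<in> balanced"
  consider "x \<in> P_H" | "reflection x \<in> P_H" using assms(1) unfolding balanced_def by blast
  then show False
  proof cases
    case 1
    then show False using P_H_no_move_to_balanced y assms(2) by blast
  next
    case 2
    then show False
      using P_H_no_move_to_balanced[of "reflection x" "reflection y"] y assms(2)
      by (simp add: setnim_move_H_reflection)
  qed
qed

section \<open>Absorption\<close>

text \<open>
  Only the componentwise order and the move set need checking below: a target that is balanced
  differs from an unbalanced starting position.
\<close>

lemma setnim_move_to_balancedI:
  assumes "(a, b, c, d, e, f) \<notin> balanced" "(a', b', c', d', e', f') \<in> balanced"
    and "a' \<le> a" "b' \<le> b" "c' \<le> c" "d' \<le> d" "e' \<le> e" "f' \<le> f"
    and "d' = d \<and> e' = e \<and> f' = f \<or> a' = a \<and> e' = e \<and> f' = f \<or> a' = a \<and> b' = b \<and> f' = f \<or>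
      a' = a \<and> b' = b \<and> c' = c \<or> b' = b \<and> c' = c \<and> d' = d \<and> e' = e"
  shows "\<exists>y\<in>balanced. setnim_move H_sets (position (a, b, c, d, e, f)) (position y)"
proof (rule bexI[OF _ assms(2)])
  have "(a, b, c, d, e, f) \<noteq> (a', b', c', d', e', f')" using assms(1,2) by metis
  then show "setnim_move H_sets (position (a, b, c, d, e, f)) (position (a', b', c', d', e', f'))"
    unfolding setnim_move_H_iff using assms(3-9) by blast
qed

text \<open>
  Put \<open>d' = min a d\<close> and \<open>m = a - d'\<close>, so that \<open>m \<le> c\<close> and \<open>m \<le> e\<close>. Lowering \<open>d\<close> to \<open>d'\<close>, and at
  least one of \<open>c\<close> and \<open>e\<close> to \<open>m\<close>, yields \<open>a = d' + min c' e'\<close>. It remains to equate the half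
  sums, which with \<open>a = d' + m\<close> means \<open>b' + c' + m = e' + f'\<close>. The move set depends on where \<open>b\<close> lies
  relative to \<open>f\<close>: a very large \<open>b\<close> must be lowered too, a very large \<open>f\<close> must be lowered too, and in
  between one of \<open>e\<close> and \<open>c\<close> absorbs the difference.
\<close>

lemma absorbing_low_a:
  assumes unbalanced: "(a, b, c, d, e, f) \<notin> balanced"
    and "a \<le> f" "a \<le> d + min c e"
  shows "\<exists>y\<in>balanced. setnim_move H_sets (position (a, b, c, d, e, f)) (position y)"
proof -
  define d' where "d' = min a d"
  define m where "m = a - d'"
  have m: "a = d' + m" "d' \<le> d" "m \<le> c" "m \<le> e"
    using assms(2,3) unfolding m_def d'_def by auto
  consider "e + f < b + 2 * m" | "f \<le> b + m" "b + 2 * m \<le> e + f"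
    | "b + m < f" "f \<le> b + c" | "b + c < f" by linarith
  then show ?thesis
  proof cases
    case 1
    then have target: "(a, e + f - 2 * m, m, d', e, f) \<in> balanced"
      using m assms(2) unfolding balanced_iff by auto
    show ?thesis
      by (rule setnim_move_to_balancedI[OF unbalanced target]) (use m 1 in auto)
  next
    case 2
    then have target: "(a, b, m, d', b + 2 * m - f, f) \<in> balanced"
      using m assms(2) unfolding balanced_iff by auto
    show ?thesis
      by (rule setnim_move_to_balancedI[OF unbalanced target]) (use m 2 in auto)
  next
    case 3
    then have target: "(a, b, f - b, d', m, f) \<in> balanced"
      using m assms(2) unfolding balanced_iff by auto
    show ?thesis
      by (rule setnim_move_to_balancedI[OF unbalanced target]) (use m 3 in auto)
  next
    case 4
    \<comment> \<open>The orientation is reversed if \<open>b + c < a\<close>; then \<open>b < d'\<close> because \<open>a \<le> d' + c\<close>,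
      and so the new value \<open>b + c\<close> of \<open>f\<close> is \<open>c + min d' b\<close>.\<close>
    have target: "(a, b, c, d', m, b + c) \<in> balanced"
      using m unfolding balanced_iff by auto
    show ?thesis
      by (rule setnim_move_to_balancedI[OF unbalanced target]) (use m 4 in auto)
  qed
qed

text \<open>
  A discrete intermediate value property: \<open>t + min t k\<close> can be brought within \<open>s\<close> below \<open>k + l\<close>,
  even for \<open>s = 0\<close> where its steps of two might jump over \<open>k + l\<close>. The least \<open>t\<close> that is large
  enough does it: steps of two occur only up to \<open>t = k\<close>, where \<open>2 * t \<le> k + l\<close> holds anyway
  because \<open>min n k \<le> l\<close>.
\<close>

lemma ex_add_min_within:
  fixes k l s n :: nat
  assumes "min n k \<le> l" "k + l \<le> s + n + min n k"
  shows "\<exists>t\<le>n. k + l \<le> s + t + min t k \<and> t + min t k \<le> k + l"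
proof -
  define Q where "Q t \<longleftrightarrow> k + l \<le> s + t + min t k" for t
  have "Q n" using assms(2) unfolding Q_def .
  then obtain t where t: "Q t" "t \<le> n" and least: "\<And>u. u < t \<Longrightarrow> \<not> Q u"
    using LeastI[of Q n] Least_le[of Q n] not_less_Least[of _ Q] by blast
  have "t + min t k \<le> k + l"
  proof (cases "t \<le> k")
    case True
    then show ?thesis using t(2) assms(1) by auto
  next
    case False
    then have "\<not> Q (t - 1)" using least by simp
    then show ?thesis using False unfolding Q_def by auto
  qed
  then show ?thesis using t unfolding Q_def by blast
qed

text \<open>
  With \<open>b, c, d, e\<close> kept, the target of either orientation is determined by the defining equations,
  and it has that orientation according to how \<open>b + c\<close> compares with \<open>d + e\<close>. The required
  \<open>a'\<close> (for \<open>a' \<le> f'\<close>) or \<open>f'\<close> (for \<open>f' \<le> a'\<close>) never exceeds its stack. If the other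
  coordinate does, then it is kept, and \<open>ex_add_min_within\<close> finds a suitable \<open>c'\<close> or \<open>d'\<close> by
  which to equate the half sums.
\<close>

lemma absorbing_high_a:
  assumes unbalanced: "(a, b, c, d, e, f) \<notin> balanced"
    and "a \<le> f" "d + min c e \<le> a"
  shows "\<exists>y\<in>balanced. setnim_move H_sets (position (a, b, c, d, e, f)) (position y)"
proof (cases "d + e \<le> b + c")
  case le: True
  show ?thesis
  proof (cases "b + c + min c e \<le> e + f")
    case True
    have target: "(d + min c e, b, c, d, e, b + c + min c e - e) \<in> balanced"
      using le unfolding balanced_iff by auto
    show ?thesis
      by (rule setnim_move_to_balancedI[OF unbalanced target]) (use le True assms(3) in auto)
  next
    case False
    have "min c e \<le> f" "e + f \<le> b + c + min c e" using assms(2,3) False by linarith+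
    from ex_add_min_within[OF this] obtain t
      where t: "t \<le> c" "e + f \<le> b + t + min t e" "t + min t e \<le> e + f" by blast
    have a': "d + min t e \<le> a" using t(1) assms(3) by auto
    have target: "(d + min t e, e + f - (t + min t e), t, d, e, f) \<in> balanced"
      using t(3) a' assms(2) unfolding balanced_iff by auto
    show ?thesis
      by (rule setnim_move_to_balancedI[OF unbalanced target]) (use t a' in auto)
  qed
next
  case gt: False
  have c_le: "c + min d b \<le> a" using gt assms(3) by auto
  show ?thesis
  proof (cases "d + e + min d b \<le> a + b")
    case True
    have target: "(d + e + min d b - b, b, c, d, e, c + min d b) \<in> balanced"
      using gt unfolding balanced_iff by auto
    show ?thesis
      by (rule setnim_move_to_balancedI[OF unbalanced target]) (use True c_le assms(2) in auto)
  next
    case False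
    have "min d b \<le> a" "b + a \<le> e + d + min d b" using assms(3) False by linarith+
    from ex_add_min_within[OF this] obtain t
      where t: "t \<le> d" "b + a \<le> e + t + min t b" "t + min t b \<le> b + a" by blast
    have f': "c + min t b \<le> a" using t(1) c_le by auto
    have target: "(a, b, c, t, b + a - (t + min t b), c + min t b) \<in> balanced"
      using t(3) f' unfolding balanced_iff by auto
    show ?thesis
      by (rule setnim_move_to_balancedI[OF unbalanced target]) (use t f' assms(2) in auto)
  qed
qed

lemma balanced_absorbing:
  assumes "x \<notin> balanced"
  shows "\<exists>y\<in>balanced. setnim_move H_sets (position x) (position y)"
proof -
  have oriented: "\<exists>y\<in>balanced. setnim_move H_sets (position (a, b, c, d, e, f)) (position y)"
    if "(a, b, c, d, e, f) \<notin> balanced" "a \<le> f" for a b c d e f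
    using absorbing_low_a absorbing_high_a that by (meson nle_le)
  obtain a b c d e f where x: "x = (a, b, c, d, e, f)" by (cases x)
  show ?thesis
  proof (cases "a \<le> f")
    case True
    then show ?thesis using oriented assms unfolding x by blast
  next
    case False
    have "reflection x \<notin> balanced" using assms by simp
    then obtain y where "y \<in> balanced"
      "setnim_move H_sets (position (reflection x)) (position y)"
      using oriented[of f e d c b a] False unfolding x by auto
    then have "reflection y \<in> balanced" "setnim_move H_sets (position x) (position (reflection y))"
      using setnim_move_H_reflection[of x "reflection y"] by simp_all
    then show ?thesis by blast
  qed
qed

section \<open>The \<open>\<P>\<close>-positions of \<open>H\<close>\<close>

theorem theorem4p2:
  fixes x :: "nat \<times> nat \<times> nat \<times> nat \<times> nat \<times> nat"
  shows "P_position H_sets (position x) \<longleftrightarrow> x \<in> P_H \<or> reflection x \<in> P_H"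
proof -
  have "P_position H_sets (position x) \<longleftrightarrow> position x \<in> position ` balanced"
  proof (rule P_position_iff_kernel[OF wfp_setnim_move[OF finite_UNIV_stack]])
    fix p q assume "p \<in> position ` balanced" "setnim_move H_sets p q"
    then show "q \<notin> position ` balanced" using balanced_independent by blast
  next
    fix p assume "p \<notin> position ` balanced"
    moreover obtain z where "p = position z" using bij_position by (metis bij_pointE)
    ultimately show "\<exists>q\<in>position ` balanced. setnim_move H_sets p q"
      using balanced_absorbing[of z] by blast
  qed
  also have "\<dots> \<longleftrightarrow> x \<in> balanced"
    using bij_position by (simp add: bij_is_inj inj_image_mem_iff)
  finally show ?thesis unfolding balanced_def by simp
qed

end
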